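(* Let $P$ be a finite set of atomic propositions, $T\in\mathbb{N}$, $\mathbb{T}=\{0,1,\dots,T\}$, and let $x:\mathbb{T}\to 2^P$ be a discrete-time signal. For every MTL formula $\varphi$ (built from the grammar given in the context, with closed time intervals $[a,b]$, $a,b\in\mathbb{N}$, $0\le a\le b$) and every $i\in\mathbb{T}$, the LTI-filtering value of $\varphi$ at $i$ equals $1$ if and only if $(x,i)\models_C\varphi$ in the classical semantics, i.e. $(x,i)\models_L\varphi \iff (x,i)\models_C\varphi$.
   Context: For $p\in P$, $x_p:\mathbb{T}\to\{0,1\}$ is the projection, $x_p[i]=1$ iff $p\in x[i]$. Formulas: $\varphi ::= p \mid \neg\varphi \mid \varphi_1\vee\varphi_2 \mid \varphi_1 U_I\varphi_2 \mid \varphi_1 S_I \varphi_2 \mid F_I\varphi\mid G_I\varphi\mid P_I\varphi\mid H_I\varphi$ (also $\wedge$, with $\varphi\wedge\psi=\neg(\neg\varphi\vee\neg\psi)$). Classical semantics $\models_C$: $(x,i)\models p$ iff $x_p[i]=1$; $\neg,\vee$ as usual; $(x,i)\models \varphi U_I\psi$ iff there is $j\in(i+I)\cap\mathbb{T}$ with $(x,j)\models\psi$ and $(x,k)\models\varphi$ for all integers $k$ with $i<k<j$; $(x,i)\models\varphi S_I\psi$ iff there is $j\in(i-I)\cap\mathbb{T}$ with $(x,j)\models\psi$ and $(x,k)\models\varphi$ for all integers $k$ with $j<k<i$; $(x,i)\models F_I\varphi$ iff $\exists j\in(i+I)\cap\mathbb{T}$ with $(x,j)\models\varphi$; $G_I\varphi$: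 for all $j\in(i+I)\cap\mathbb{T}$; $P_I\varphi$: $\exists j\in(i-I)\cap\mathbb{T}$; $H_I\varphi$: for all $j\in(i-I)\cap\mathbb{T}$. LTI-filtering semantics $\models_L$ (values in $\{0,1\}$, interpreting addition and multiplication in the max–min dioid): let $\delta$ be the Kronecker delta ($\delta(0)=1$, $\delta(n)=0$ otherwise), and for a closed integer interval $I$ (possibly empty, $[a,b]$ with $b<a$ being empty) define unnormalized windows $w^+_I[t]=\max_{k\in I}\delta(t+k)$ and $w^-_I[t]=\max_{k\in I}\delta(t-k)$ (identically $0$ if $I=\emptyset$). Then: $(x,i)\models_L p = x_p[i]$; $(x,i)\models_L\neg\varphi = 1-((x,i)\models_L\varphi)$; $(x,i)\models_L\varphi\vee\psi=\max$ of the two values; $(x,i)\models_L F_I\varphi=\max_{j\in\mathbb{T}}\min((x,j)\models_L\varphi,\,w^+_I[i-j])$; $(x,i)\models_L G_I\varphi = 1-((x,i)\models_L F_I\neg\varphi)$; $(x,i)\models_L P_I\varphi=\max_{j\in\mathbb{T}}\min((x,j)\models_L\varphi,\,w^-_I[i-j])$; $(x,i)\models_L H_I\varphi=1-((x,i)\models_L P_I\neg\varphi)$; $(x,i)\models_L\varphi U_I\psi=\max_{j\in I}\min((x,i)\models_L G_{[1,j-1]}\varphi,\ (x,i)\models_L F_{[j,j]}\psi)$; $(x,i)\models_L\varphi S_I\psi=\max_{j\in I}\min((x,i)\models_L H_{[1,j-1]}\varphi,\ (x,i)\models_L P_{[j,j]}\psi)$. "$(x,i)\models_L\varphi$" means this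 value is $1$. *)

theory Defs
  imports Complex_Main "HOL-Library.FuncSet"
begin

text \<open>
  The two integers carried by a temporal operator are the endpoints of its closed interval
  \<^term>\<open>{a..b}\<close>. Integer endpoints make the intervals \<open>[1, j - 1]\<close> of the filtering semantics
  of \<open>U\<close> and \<open>S\<close> expressible also for \<open>j = 0\<close>, where the interval is empty; the condition
  \<open>0 \<le> a \<le> b\<close> of the grammar is imposed by \<open>mtl_formula\<close>.
\<close>

datatype 'p mtl =
    Atom 'p
  | Not "'p mtl"
  | Or "'p mtl" "'p mtl"
  | Until "'p mtl" int int "'p mtl"
  | Since "'p mtl" int int "'p mtl"
  | Finally int int "'p mtl"
  | Globally int int "'p mtl"
  | Past int int "'p mtl"
  | Historically int int "'p mtl"

abbreviation And :: "'p mtl \<Rightarrow> 'p mtl \<Rightarrow> 'p mtl" where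
  "And \<phi> \<psi> \<equiv> Not (Or (Not \<phi>) (Not \<psi>))"

primrec mtl_formula :: "'p set \<Rightarrow> 'p mtl \<Rightarrow> bool" where
  "mtl_formula P (Atom p) \<longleftrightarrow> p \<in> P"
| "mtl_formula P (Not \<phi>) \<longleftrightarrow> mtl_formula P \<phi>"
| "mtl_formula P (Or \<phi> \<psi>) \<longleftrightarrow> mtl_formula P \<phi> \<and> mtl_formula P \<psi>"
| "mtl_formula P (Until \<phi> a b \<psi>) \<longleftrightarrow>
     0 \<le> a \<and> a \<le> b \<and> mtl_formula P \<phi> \<and> mtl_formula P \<psi>"
| "mtl_formula P (Since \<phi> a b \<psi>) \<longleftrightarrow>
     0 \<le> a \<and> a \<le> b \<and> mtl_formula P \<phi> \<and> mtl_formula P \<psi>"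
| "mtl_formula P (Finally a b \<phi>) \<longleftrightarrow> 0 \<le> a \<and> a \<le> b \<and> mtl_formula P \<phi>"
| "mtl_formula P (Globally a b \<phi>) \<longleftrightarrow> 0 \<le> a \<and> a \<le> b \<and> mtl_formula P \<phi>"
| "mtl_formula P (Past a b \<phi>) \<longleftrightarrow> 0 \<le> a \<and> a \<le> b \<and> mtl_formula P \<phi>"
| "mtl_formula P (Historically a b \<phi>) \<longleftrightarrow> 0 \<le> a \<and> a \<le> b \<and> mtl_formula P \<phi>"

definition time :: "nat \<Rightarrow> int set" where
  "time T = {0..int T}"

definition proj :: "(int \<Rightarrow> 'p set) \<Rightarrow> 'p \<Rightarrow> int \<Rightarrow> nat" where
  "proj x p i = (if p \<in> x i then 1 else 0)"

primrec sat_C :: "nat \<Rightarrow> (int \<Rightarrow> 'p set) \<Rightarrow> 'p mtl \<Rightarrow> int \<Rightarrow> bool" where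
  "sat_C T x (Atom p) i \<longleftrightarrow> proj x p i = 1"
| "sat_C T x (Not \<phi>) i \<longleftrightarrow> \<not> sat_C T x \<phi> i"
| "sat_C T x (Or \<phi> \<psi>) i \<longleftrightarrow> sat_C T x \<phi> i \<or> sat_C T x \<psi> i"
| "sat_C T x (Until \<phi> a b \<psi>) i \<longleftrightarrow>
     (\<exists>j \<in> (\<lambda>k. i + k) ` {a..b} \<inter> time T.
        sat_C T x \<psi> j \<and> (\<forall>k. i < k \<and> k < j \<longrightarrow> sat_C T x \<phi> k))"
| "sat_C T x (Since \<phi> a b \<psi>) i \<longleftrightarrow>
     (\<exists>j \<in> (\<lambda>k. i - k) ` {a..b} \<inter> time T.
        sat_C T x \<psi> j \<and> (\<forall>k. j < k \<and> k < i \<longrightarrow> sat_C T x \<phi> k))"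
| "sat_C T x (Finally a b \<phi>) i \<longleftrightarrow> (\<exists>j \<in> (\<lambda>k. i + k) ` {a..b} \<inter> time T. sat_C T x \<phi> j)"
| "sat_C T x (Globally a b \<phi>) i \<longleftrightarrow> (\<forall>j \<in> (\<lambda>k. i + k) ` {a..b} \<inter> time T. sat_C T x \<phi> j)"
| "sat_C T x (Past a b \<phi>) i \<longleftrightarrow> (\<exists>j \<in> (\<lambda>k. i - k) ` {a..b} \<inter> time T. sat_C T x \<phi> j)"
| "sat_C T x (Historically a b \<phi>) i \<longleftrightarrow> (\<forall>j \<in> (\<lambda>k. i - k) ` {a..b} \<inter> time T. sat_C T x \<phi> j)"

definition kdelta :: "int \<Rightarrow> nat" where
  "kdelta n = (if n = 0 then 1 else 0)"

text \<open>
  Maxima are written with \<open>SUP\<close> on \<^typ>\<open>nat\<close>, which is the maximum of a nonempty finite set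
  and \<open>0\<close>, the zero of the max--min dioid, on the empty set.
\<close>

definition window_plus :: "int \<Rightarrow> int \<Rightarrow> int \<Rightarrow> nat" where
  "window_plus a b t = (SUP k\<in>{a..b}. kdelta (t + k))"

definition window_minus :: "int \<Rightarrow> int \<Rightarrow> int \<Rightarrow> nat" where
  "window_minus a b t = (SUP k\<in>{a..b}. kdelta (t - k))"

text \<open>
  Termination measure for the filtering semantics, in which \<open>U\<close> and \<open>S\<close> are reduced to
  \<open>G\<close>, \<open>F\<close> and \<open>H\<close>, \<open>P\<close>, and \<open>G\<close>, \<open>H\<close> to \<open>F\<close>, \<open>P\<close> of a negation.
\<close>

primrec weight :: "'p mtl \<Rightarrow> nat" where
  "weight (Atom p) = 0"
| "weight (Not \<phi>) = weight \<phi> + 1"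
| "weight (Or \<phi> \<psi>) = weight \<phi> + weight \<psi> + 1"
| "weight (Until \<phi> a b \<psi>) = weight \<phi> + weight \<psi> + 4"
| "weight (Since \<phi> a b \<psi>) = weight \<phi> + weight \<psi> + 4"
| "weight (Finally a b \<phi>) = weight \<phi> + 1"
| "weight (Globally a b \<phi>) = weight \<phi> + 3"
| "weight (Past a b \<phi>) = weight \<phi> + 1"
| "weight (Historically a b \<phi>) = weight \<phi> + 3"

function lti :: "nat \<Rightarrow> (int \<Rightarrow> 'p set) \<Rightarrow> 'p mtl \<Rightarrow> int \<Rightarrow> nat" where
  "lti T x (Atom p) i = proj x p i"
| "lti T x (Not \<phi>) i = 1 - lti T x \<phi> i"
| "lti T x (Or \<phi> \<psi>) i = max (lti T x \<phi> i) (lti T x \<psi> i)"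
| "lti T x (Until \<phi> a b \<psi>) i =
     (SUP j\<in>{a..b}. min (lti T x (Globally 1 (j - 1) \<phi>) i) (lti T x (Finally j j \<psi>) i))"
| "lti T x (Since \<phi> a b \<psi>) i =
     (SUP j\<in>{a..b}. min (lti T x (Historically 1 (j - 1) \<phi>) i) (lti T x (Past j j \<psi>) i))"
| "lti T x (Finally a b \<phi>) i = (SUP j\<in>time T. min (lti T x \<phi> j) (window_plus a b (i - j)))"
| "lti T x (Globally a b \<phi>) i = 1 - lti T x (Finally a b (Not \<phi>)) i"
| "lti T x (Past a b \<phi>) i = (SUP j\<in>time T. min (lti T x \<phi> j) (window_minus a b (i - j)))"
| "lti T x (Historically a b \<phi>) i = 1 - lti T x (Past a b (Not \<phi>)) i"
  by pat_completeness auto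
termination
  by (relation "measure (\<lambda>(T, x, \<phi>, i). weight \<phi>)") auto

definition sat_L :: "nat \<Rightarrow> (int \<Rightarrow> 'p set) \<Rightarrow> 'p mtl \<Rightarrow> int \<Rightarrow> bool" where
  "sat_L T x \<phi> i \<longleftrightarrow> lti T x \<phi> i = 1"

end

theory Submission
  imports Defs
begin

text \<open>
  Every filtering value lies in \<open>{0, 1}\<close>, where the operations of the max--min dioid are the
  Boolean ones, so the value of a formula is the indicator of its classical truth. For \<open>F\<close> and
  \<open>P\<close> the window evaluated at \<open>i - j\<close> is \<open>1\<close> exactly when \<open>j\<close> lies in the shifted interval. For \<open>U\<close> and \<open>S\<close>,
  \<open>G\<close> and \<open>H\<close> quantify over time points of \<open>time T\<close> only, whereas the classical semantics
  quantifies over all integers strictly between \<open>i\<close> and \<open>j\<close>; these agree because \<open>time T\<close> is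
  convex and contains both ends.
\<close>

text \<open>Translates dioid sums into existential quantifiers. Empty \<open>A\<close> is included,
  since \<open>{1..j - 1}\<close> may be empty.\<close>

lemma SUP_of_bool_nat:
  assumes "finite A"
  shows "(SUP a\<in>A. of_bool (Q a) :: nat) = of_bool (\<exists>a\<in>A. Q a)"
proof (cases "\<exists>a\<in>A. Q a")
  case True
  then have "Max ((\<lambda>a. of_bool (Q a) :: nat) ` A) = 1"
    using assms by (intro Max_eqI) (auto simp: image_iff)
  with True show ?thesis
    by (auto simp: Sup_nat_def)
next
  case False
  \<comment> \<open>All terms vanish. The supremum of the constant image is 0 if \<open>A\<close> is
    nonempty, and for empty \<open>A\<close> it is 0 by the convention for \<open>Sup\<close> on
    naturals.\<close>
  then have "(SUP a\<in>A. of_bool (Q a) :: nat) = (SUP a\<in>A. 0)"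
    by (intro SUP_cong) auto
  with False show ?thesis
    by (cases "A = {}") (simp_all add: Sup_nat_def image_constant_conv)
qed

lemma min_of_bool_nat: "min (of_bool p) (of_bool q) = (of_bool (p \<and> q) :: nat)"
  by simp

lemma finite_time: "finite (time T)"
  by (simp add: time_def)

lemma window_plus_eq: "window_plus a b (i - j) = of_bool (j \<in> (\<lambda>k. i + k) ` {a..b})"
proof -
  have "window_plus a b (i - j) = (SUP k\<in>{a..b}. of_bool (j = i + k))"
    unfolding window_plus_def by (intro SUP_cong) (auto simp: kdelta_def)
  then show ?thesis
    by (simp only: SUP_of_bool_nat finite_atLeastAtMost_int image_iff)
qed

lemma window_minus_eq: "window_minus a b (i - j) = of_bool (j \<in> (\<lambda>k. i - k) ` {a..b})"
proof -
  have "window_minus a b (i - j) = (SUP k\<in>{a..b}. of_bool (j = i - k))"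
    unfolding window_minus_def by (intro SUP_cong) (auto simp: kdelta_def)
  then show ?thesis
    by (simp only: SUP_of_bool_nat finite_atLeastAtMost_int image_iff)
qed

text \<open>\<open>Q\<close> is an arbitrary predicate, constrained only on \<open>time T\<close>,
  so that the lemma applies equally to the complement of \<open>Q\<close> in the dual case and to
  the operands of \<open>Until\<close>.\<close>

lemma lti_Finally_eq:
  assumes "\<And>j. j \<in> time T \<Longrightarrow> lti T x \<phi> j = of_bool (Q j)"
  shows "lti T x (Finally a b \<phi>) i = of_bool (\<exists>j \<in> (\<lambda>k. i + k) ` {a..b} \<inter> time T. Q j)"
proof -
  have "lti T x (Finally a b \<phi>) i =
      (SUP j\<in>time T. of_bool (Q j \<and> j \<in> (\<lambda>k. i + k) ` {a..b}))"
    unfolding lti.simps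
    by (intro SUP_cong refl) (simp only: assms window_plus_eq min_of_bool_nat)
  then show ?thesis
    unfolding SUP_of_bool_nat[OF finite_time] by (auto intro!: arg_cong[of _ _ of_bool])
qed

lemma lti_Past_eq:
  assumes "\<And>j. j \<in> time T \<Longrightarrow> lti T x \<phi> j = of_bool (Q j)"
  shows "lti T x (Past a b \<phi>) i = of_bool (\<exists>j \<in> (\<lambda>k. i - k) ` {a..b} \<inter> time T. Q j)"
proof -
  have "lti T x (Past a b \<phi>) i =
      (SUP j\<in>time T. of_bool (Q j \<and> j \<in> (\<lambda>k. i - k) ` {a..b}))"
    unfolding lti.simps
    by (intro SUP_cong refl) (simp only: assms window_minus_eq min_of_bool_nat)
  then show ?thesis
    unfolding SUP_of_bool_nat[OF finite_time] by (auto intro!: arg_cong[of _ _ of_bool])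
qed

text \<open>De Morgan duality with \<open>Finally\<close>. The endpoints are unrestricted: on an
  empty interval the inner maximum is 0, so the value is 1, matching the vacuous quantifier.\<close>

lemma lti_Globally_eq:
  assumes "\<And>j. j \<in> time T \<Longrightarrow> lti T x \<phi> j = of_bool (Q j)"
  shows "lti T x (Globally a b \<phi>) i = of_bool (\<forall>j \<in> (\<lambda>k. i + k) ` {a..b} \<inter> time T. Q j)"
proof -
  have "lti T x (Finally a b (Not \<phi>)) i =
      of_bool (\<exists>j \<in> (\<lambda>k. i + k) ` {a..b} \<inter> time T. \<not> Q j)"
    by (rule lti_Finally_eq) (simp add: assms)
  then show ?thesis
    unfolding lti.simps(7) by auto
qed

lemma lti_Historically_eq:
  assumes "\<And>j. j \<in> time T \<Longrightarrow> lti T x \<phi> j = of_bool (Q j)"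
  shows "lti T x (Historically a b \<phi>) i = of_bool (\<forall>j \<in> (\<lambda>k. i - k) ` {a..b} \<inter> time T. Q j)"
proof -
  have "lti T x (Past a b (Not \<phi>)) i =
      of_bool (\<exists>j \<in> (\<lambda>k. i - k) ` {a..b} \<inter> time T. \<not> Q j)"
    by (rule lti_Past_eq) (simp add: assms)
  then show ?thesis
    unfolding lti.simps(9) by auto
qed

lemma lti_Until_eq:
  assumes "\<And>j. j \<in> time T \<Longrightarrow> lti T x \<phi> j = of_bool (Q j)"
    and "\<And>j. j \<in> time T \<Longrightarrow> lti T x \<psi> j = of_bool (R j)"
    and i: "i \<in> time T"
  shows "lti T x (Until \<phi> a b \<psi>) i =
    of_bool (\<exists>j \<in> (\<lambda>k. i + k) ` {a..b} \<inter> time T. R j \<and> (\<forall>k. i < k \<and> k < j \<longrightarrow> Q k))"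
proof -
  \<comment> \<open>The condition on \<open>d\<close> matters: if \<open>i + d\<close> lay beyond
    the horizon, the right side would also constrain points after \<open>T\<close>. For
    \<open>d \<le> 1\<close> both sides are vacuous.\<close>
  have between: "(\<forall>k \<in> (\<lambda>k. i + k) ` {1..d - 1} \<inter> time T. Q k) \<longleftrightarrow>
      (\<forall>k. i < k \<and> k < i + d \<longrightarrow> Q k)" if "i + d \<in> time T" for d
  proof -
    have "(\<lambda>k. i + k) ` {1..d - 1} \<inter> time T = {k. i < k \<and> k < i + d}"
      using i that by (auto simp: time_def)
    then show ?thesis by simp
  qed
  have "lti T x (Until \<phi> a b \<psi>) i = (SUP d\<in>{a..b}. of_bool
      ((\<forall>k \<in> (\<lambda>k. i + k) ` {1..d - 1} \<inter> time T. Q k) \<and>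
       (\<exists>j \<in> (\<lambda>k. i + k) ` {d..d} \<inter> time T. R j)))"
    unfolding lti.simps(4)
    by (simp only: lti_Globally_eq[OF assms(1)] lti_Finally_eq[OF assms(2)] min_of_bool_nat)
  \<comment> \<open>The interval \<open>{d..d}\<close> leaves \<open>i + d\<close> as the only
    candidate for \<open>j\<close>. Its membership in \<open>time T\<close> is placed first, so that
    \<open>conj_cong\<close> can supply it below as the premise of \<open>between\<close>.\<close>
  also have "\<dots> = of_bool (\<exists>d\<in>{a..b}. i + d \<in> time T \<and> R (i + d) \<and>
      (\<forall>k \<in> (\<lambda>k. i + k) ` {1..d - 1} \<inter> time T. Q k))"
    unfolding SUP_of_bool_nat[OF finite_atLeastAtMost_int]
    by (intro arg_cong[of _ _ of_bool] bex_cong refl) auto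
  also have "\<dots> = of_bool (\<exists>d\<in>{a..b}. i + d \<in> time T \<and> R (i + d) \<and>
      (\<forall>k. i < k \<and> k < i + d \<longrightarrow> Q k))"
    by (simp only: between cong: conj_cong)
  also have "\<dots> = of_bool (\<exists>j \<in> (\<lambda>k. i + k) ` {a..b} \<inter> time T.
      R j \<and> (\<forall>k. i < k \<and> k < j \<longrightarrow> Q k))"
    by (rule arg_cong[of _ _ of_bool]) blast
  finally show ?thesis .
qed

lemma lti_Since_eq:
  assumes "\<And>j. j \<in> time T \<Longrightarrow> lti T x \<phi> j = of_bool (Q j)"
    and "\<And>j. j \<in> time T \<Longrightarrow> lti T x \<psi> j = of_bool (R j)"
    and i: "i \<in> time T"
  shows "lti T x (Since \<phi> a b \<psi>) i =
    of_bool (\<exists>j \<in> (\<lambda>k. i - k) ` {a..b} \<inter> time T. R j \<and> (\<forall>k. j < k \<and> k < i \<longrightarrow> Q k))"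
proof -
  have between: "(\<forall>k \<in> (\<lambda>k. i - k) ` {1..d - 1} \<inter> time T. Q k) \<longleftrightarrow>
      (\<forall>k. i - d < k \<and> k < i \<longrightarrow> Q k)" if "i - d \<in> time T" for d
  proof -
    \<comment> \<open>The bounds swap roles compared with \<open>Until\<close>: here
      \<open>i - d\<close> keeps the points nonnegative and \<open>i\<close> keeps them at most
      \<open>T\<close>.\<close>
    have "(\<lambda>k. i - k) ` {1..d - 1} \<inter> time T = {k. i - d < k \<and> k < i}"
      using i that by (auto simp: time_def)
    then show ?thesis by simp
  qed
  have "lti T x (Since \<phi> a b \<psi>) i = (SUP d\<in>{a..b}. of_bool
      ((\<forall>k \<in> (\<lambda>k. i - k) ` {1..d - 1} \<inter> time T. Q k) \<and>
       (\<exists>j \<in> (\<lambda>k. i - k) ` {d..d} \<inter> time T. R j)))"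
    unfolding lti.simps(5)
    by (simp only: lti_Historically_eq[OF assms(1)] lti_Past_eq[OF assms(2)] min_of_bool_nat)
  also have "\<dots> = of_bool (\<exists>d\<in>{a..b}. i - d \<in> time T \<and> R (i - d) \<and>
      (\<forall>k \<in> (\<lambda>k. i - k) ` {1..d - 1} \<inter> time T. Q k))"
    unfolding SUP_of_bool_nat[OF finite_atLeastAtMost_int]
    by (intro arg_cong[of _ _ of_bool] bex_cong refl) auto
  also have "\<dots> = of_bool (\<exists>d\<in>{a..b}. i - d \<in> time T \<and> R (i - d) \<and>
      (\<forall>k. i - d < k \<and> k < i \<longrightarrow> Q k))"
    by (simp only: between cong: conj_cong)
  also have "\<dots> = of_bool (\<exists>j \<in> (\<lambda>k. i - k) ` {a..b} \<inter> time T.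
      R j \<and> (\<forall>k. j < k \<and> k < i \<longrightarrow> Q k))"
    by (rule arg_cong[of _ _ of_bool]) blast
  finally show ?thesis .
qed

text \<open>Structural induction suffices although \<open>lti\<close> recurses through formulas that
  are not subformulas: the preceding lemmas reduce each operator to values of its operands on
  \<open>time T\<close>. The point \<open>i\<close> is generalized because temporal operators
  evaluate operands at other times.\<close>

lemma lti_eq_of_bool_sat_C:
  assumes "i \<in> time T"
  shows "lti T x \<phi> i = of_bool (sat_C T x \<phi> i)"
  using assms
proof (induction \<phi> arbitrary: i)
  case (Atom p)
  show ?case by (simp add: proj_def)
next
  case (Not \<phi>)
  then show ?case by simp
next
  case (Or \<phi> \<psi>)
  then show ?case by simp
next
  case (Until \<phi> a b \<psi>)
  then show ?case unfolding sat_C.simps by (intro lti_Until_eq)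
next
  case (Since \<phi> a b \<psi>)
  then show ?case unfolding sat_C.simps by (intro lti_Since_eq)
next
  case (Finally a b \<phi>)
  then show ?case unfolding sat_C.simps by (intro lti_Finally_eq)
next
  case (Globally a b \<phi>)
  then show ?case unfolding sat_C.simps by (intro lti_Globally_eq)
next
  case (Past a b \<phi>)
  then show ?case unfolding sat_C.simps by (intro lti_Past_eq)
next
  case (Historically a b \<phi>)
  then show ?case unfolding sat_C.simps by (intro lti_Historically_eq)
qed

theorem theorem1:
  fixes P :: "'p set" and T :: nat and x :: "int \<Rightarrow> 'p set" and \<phi> :: "'p mtl" and i :: int
  assumes "finite P"
    and "x \<in> time T \<rightarrow> Pow P"
    and "mtl_formula P \<phi>"
    and "i \<in> time T"
  shows "sat_L T x \<phi> i \<longleftrightarrow> sat_C T x \<phi> i"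
  using assms(4) by (simp add: sat_L_def lti_eq_of_bool_sat_C)

end
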